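(* Let $P_{(3,0)}$ be the set of all cylindric partitions with profile $c=(3,0)$. Then, as formal power series in $q$, $$\sum_{\Lambda\in P_{(3,0)}} q^{|\Lambda|}=\left(\sum_{n\ge0}\frac{q^{n^2+2n}}{(q^4;q^4)_n}\right)\frac{(-q^2;q^2)_\infty}{(q;q)_\infty}.$$
   Context: Let $r,\ell$ be positive integers and $c=(c_1,\dots,c_r)$ a composition of $\ell$ into $r$ nonnegative integer parts (zero entries allowed). A cylindric partition with profile $c$ is a tuple $\Lambda=(\lambda^{(1)},\dots,\lambda^{(r)})$ of ordinary partitions $\lambda^{(i)}=(\lambda^{(i)}_1\ge\lambda^{(i)}_2\ge\cdots)$ (parts beyond the length are taken to be $0$) such that for all $i,j$: $\lambda^{(i)}_j\ge\lambda^{(i+1)}_{j+c_{i+1}}$ for $1\le i\le r-1$, and $\lambda^{(r)}_j\ge\lambda^{(1)}_{j+c_1}$. The size $|\Lambda|$ is the sum of all parts of all $\lambda^{(i)}$; the empty cylindric partition is included with size $0$. Notation: $(a;q)_n=\prod_{k=1}^n(1-aq^{k-1})$, $(a;q)_\infty=\lim_{n\to\infty}(a;q)_n$. *)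

theory Defs
  imports "HOL-Analysis.Analysis" "HOL-Library.More_List"
begin

text \<open>A partition is the list of its positive parts in weakly decreasing order, so each partition
  has exactly one representation.\<close>

definition is_partition :: "nat list \<Rightarrow> bool" where
  "is_partition xs \<longleftrightarrow> sorted_wrt (\<ge>) xs \<and> 0 \<notin> set xs"

text \<open>Parts are indexed from 0; parts beyond the length are 0.\<close>

abbreviation nth_part :: "nat list \<Rightarrow> nat \<Rightarrow> nat" where
  "nth_part \<equiv> nth_default 0"

text \<open>The profile \<open>c\<close> is a list of length \<open>r > 0\<close>. Components are indexed from 0 as well:
  \<open>\<Lambda> ! i\<close> and \<open>c ! i\<close> stand for $\lambda^{(i+1)}$ and $c_{i+1}$.\<close>

definition cylindric_partitions :: "nat list \<Rightarrow> nat list list set" where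
  "cylindric_partitions c =
     {\<Lambda>. length \<Lambda> = length c \<and> (\<forall>xs\<in>set \<Lambda>. is_partition xs) \<and>
          (\<forall>i j. Suc i < length c \<longrightarrow>
             nth_part (\<Lambda> ! i) j \<ge> nth_part (\<Lambda> ! Suc i) (j + c ! Suc i)) \<and>
          (\<forall>j. nth_part (\<Lambda> ! (length c - 1)) j \<ge> nth_part (\<Lambda> ! 0) (j + c ! 0))}"

definition cylindric_size :: "nat list list \<Rightarrow> nat" where
  "cylindric_size \<Lambda> = sum_list (map sum_list \<Lambda>)"

definition q_pochhammer :: "'a::comm_ring_1 \<Rightarrow> 'a \<Rightarrow> nat \<Rightarrow> 'a" where
  "q_pochhammer a q n = (\<Prod>k=1..n. 1 - a * q ^ (k - 1))"

text \<open>For formal power series, the limit is taken in the \<open>X\<close>-adic topology given by the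
  \<^class>\<open>metric_space\<close> instance of the type.\<close>

definition q_pochhammer_inf :: "'a::{comm_ring_1,t2_space} \<Rightarrow> 'a \<Rightarrow> 'a" where
  "q_pochhammer_inf a q = lim (\<lambda>n. q_pochhammer a q n)"

end

theory Submission
  imports Defs
begin

text \<open>Let $A_N$ and $B_N$ be the generating functions of the cylindric partitions of profile $(2,1)$ and
  $(3,0)$ with all parts at most $N$. Deleting a part equal to $N$ gives
  $B_N = B_{N-1} + q^N A_N$ and $A_N = A_{N-1} + q^N A_N + q^N B_{N-1}$, which is solved by
  $A_N = \sum_n q^{n^2} / ((q;q)_n (q;q)_{N-n})$ and $B_N = \sum_n q^{n^2+n} / ((q;q)_n (q;q)_{N-n})$.
  Letting $N \to \infty$, the generating function for $(3,0)$ is $\sum_n q^{n^2+n} / (q;q)_n$ divided by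
  $(q;q)_\infty$. Finally $1/(q;q)_N = \sum_{n+m=N} q^n / ((q^2;q^2)_n (q^2;q^2)_m)$ turns this sum into a
  double sum, and summing over $m$ by Euler's identity
  $(-q^{2n+2};q^2)_\infty = \sum_m q^{m^2+m+2nm} / (q^2;q^2)_m$ yields the right-hand side.\<close>

section \<open>Limits of formal power series\<close>

unbundle no vec_syntax
unbundle fps_syntax

lemma fps_mult_nth_cong:
  assumes "\<And>j. j \<le> k \<Longrightarrow> F $ j = F' $ j" "\<And>j. j \<le> k \<Longrightarrow> G $ j = G' $ j"
  shows "(F * G) $ k = (F' * G') $ (k :: nat)"
  using assms by (simp add: fps_mult_nth)

lemma tendsto_fps_mult:
  fixes f g :: "'b \<Rightarrow> 'a::ring_1 fps"
  assumes "(f \<longlongrightarrow> F) net" "(g \<longlongrightarrow> G) net"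
  shows "((\<lambda>x. f x * g x) \<longlongrightarrow> F * G) net"
proof (rule tendsto_fpsI)
  fix k
  have "\<forall>\<^sub>F x in net. \<forall>j\<in>{..k}. f x $ j = F $ j \<and> g x $ j = G $ j"
    using assms unfolding tendsto_fps_iff
    by (intro eventually_ball_finite ballI eventually_conj) blast+
  then show "\<forall>\<^sub>F x in net. (f x * g x) $ k = (F * G) $ k"
    by eventually_elim (auto intro: fps_mult_nth_cong)
qed

text \<open>The hypothesis says that \<open>g n\<close> has order at least n, so coefficient k of
  the partial sums is constant from \<open>Suc k\<close> terms on.\<close>

lemma fps_sums:
  fixes g :: "nat \<Rightarrow> 'a::ab_group_add fps"
  assumes "\<And>n k. k < n \<Longrightarrow> g n $ k = 0"
  shows "g sums Abs_fps (\<lambda>k. (\<Sum>n\<le>k. g n) $ k)"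
  unfolding sums_def
proof (rule tendsto_fpsI, rule eventually_sequentiallyI)
  fix k N :: nat assume "Suc k \<le> N"
  then have "(\<Sum>n<N. g n $ k) = (\<Sum>n\<le>k. g n $ k)"
    using assms by (intro sum.mono_neutral_right) auto
  then show "sum g {..<N} $ k = Abs_fps (\<lambda>k. (\<Sum>n\<le>k. g n) $ k) $ k"
    by (simp add: fps_sum_nth)
qed

lemma fps_suminf_nth:
  fixes g :: "nat \<Rightarrow> 'a::ab_group_add fps"
  assumes "\<And>n k. k < n \<Longrightarrow> g n $ k = 0" and "k \<le> K"
  shows "suminf g $ k = (\<Sum>n\<le>K. g n) $ k"
proof -
  have "(\<Sum>n\<le>K. g n $ k) = (\<Sum>n\<le>k. g n $ k)"
    using assms by (intro sum.mono_neutral_right) auto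
  then show ?thesis
    using sums_unique[OF fps_sums[of g, OF assms(1)], symmetric] by (simp add: fps_sum_nth)
qed

lemma fps_suminf_mult:
  fixes g :: "nat \<Rightarrow> 'a::ring_1 fps"
  assumes "\<And>n k. k < n \<Longrightarrow> g n $ k = 0"
  shows "suminf g * c = (\<Sum>n. g n * c)"
proof (rule sums_unique)
  have "g sums suminf g"
    using fps_sums[of g, OF assms] by (simp add: sums_iff)
  then have "(\<lambda>N. (\<Sum>n<N. g n) * c) \<longlonglongrightarrow> suminf g * c"
    unfolding sums_def by (intro tendsto_fps_mult tendsto_const)
  then show "(\<lambda>n. g n * c) sums (suminf g * c)"
    by (simp add: sums_def sum_distrib_right)
qed

text \<open>Coefficient k sees only the terms with n \<le> k. For these N - n tends to infinity with
  N, so \<open>h (N - n)\<close> can be replaced by \<open>H\<close>.\<close>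

lemma tendsto_fps_convolution:
  fixes g h :: "nat \<Rightarrow> 'a::ring_1 fps"
  assumes g: "\<And>n k. k < n \<Longrightarrow> g n $ k = 0" and h: "h \<longlonglongrightarrow> H"
  shows "(\<lambda>N. \<Sum>n\<le>N. g n * h (N - n)) \<longlonglongrightarrow> suminf g * H"
proof (rule tendsto_fpsI)
  fix k
  have "\<forall>\<^sub>F N in sequentially. \<forall>j\<in>{..k}. h N $ j = H $ j"
    using h unfolding tendsto_fps_iff by (intro eventually_ball_finite ballI) blast+
  then obtain M where M: "\<And>N j. N \<ge> M \<Longrightarrow> j \<le> k \<Longrightarrow> h N $ j = H $ j"
    unfolding eventually_sequentially by blast
  show "\<forall>\<^sub>F N in sequentially. (\<Sum>n\<le>N. g n * h (N - n)) $ k = (suminf g * H) $ k"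
  proof (rule eventually_sequentiallyI)
    fix N assume N: "k + M \<le> N"
    have 0: "(g n * c) $ k = 0" if "n > k" for n c
      using that g by (simp add: fps_mult_nth)
    have "(\<Sum>n\<le>N. g n * h (N - n)) $ k = (\<Sum>n\<le>k. (g n * h (N - n)) $ k)"
      unfolding fps_sum_nth using N 0 by (intro sum.mono_neutral_right) auto
    also have "\<dots> = (\<Sum>n\<le>k. (g n * H) $ k)"
      using N M by (intro sum.cong fps_mult_nth_cong) auto
    also have "\<dots> = ((\<Sum>n\<le>k. g n) * H) $ k"
      by (simp add: sum_distrib_right fps_sum_nth)
    also have "\<dots> = (suminf g * H) $ k"
      using fps_suminf_nth[of g, OF g] by (intro fps_mult_nth_cong) auto
    finally show "(\<Sum>n\<le>N. g n * h (N - n)) $ k = (suminf g * H) $ k" .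
  qed
qed

section \<open>Convergence of q-Pochhammer symbols\<close>

lemma q_pochhammer_0 [simp]: "q_pochhammer a x 0 = 1"
  by (simp add: q_pochhammer_def)

lemma q_pochhammer_Suc: "q_pochhammer a x (Suc n) = q_pochhammer a x n * (1 - a * x ^ n)"
  by (simp add: q_pochhammer_def)

lemma q_pochhammer_fps_nth_0:
  fixes a x :: "'a::comm_ring_1 fps"
  assumes "a $ 0 = 0"
  shows "q_pochhammer a x n $ 0 = 1"
  using assms by (induction n) (simp_all add: q_pochhammer_Suc)

text \<open>As \<open>a\<close> and \<open>x\<close> have no constant term, \<open>a * x ^ n\<close>
  has order at least n + 1. The factor \<open>1 - a * x ^ n\<close> therefore leaves the
  coefficients up to index n alone.\<close>

lemma q_pochhammer_fps_tendsto:
  fixes a x :: "'a::comm_ring_1 fps"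
  assumes "a $ 0 = 0" "x $ 0 = 0"
  shows "q_pochhammer a x \<longlonglongrightarrow> q_pochhammer_inf a x"
proof -
  have 0: "(a * x ^ n) $ k = 0" if "k \<le> n" for n k
  proof -
    have "a $ i * (x ^ n) $ (k - i) = 0" if "i \<le> k" for i
    proof (cases "i = 0")
      case False
      with \<open>k \<le> n\<close> that have "k - i < n" by linarith
      then show ?thesis
        using startsby_zero_power_prefix[OF assms(2), of n] by simp
    qed (simp add: assms(1))
    then show ?thesis
      by (simp add: fps_mult_nth)
  qed
  have Suc: "q_pochhammer a x (Suc n) $ k = q_pochhammer a x n $ k" if "k \<le> n" for n k
  proof -
    have "(q_pochhammer a x n * (1 - a * x ^ n)) $ k = (q_pochhammer a x n * 1) $ k"
      using that 0 by (intro fps_mult_nth_cong) auto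
    then show ?thesis
      by (simp add: q_pochhammer_Suc)
  qed
  have "q_pochhammer a x n $ k = q_pochhammer a x k $ k" if "k \<le> n" for n k
    using that by (induction n rule: dec_induct) (simp_all add: Suc)
  then have "\<forall>\<^sub>F n in sequentially. q_pochhammer a x n $ k = Abs_fps (\<lambda>k. q_pochhammer a x k $ k) $ k" for k
    unfolding fps_nth_Abs_fps by (rule eventually_sequentiallyI)
  then have "q_pochhammer a x \<longlonglongrightarrow> Abs_fps (\<lambda>k. q_pochhammer a x k $ k)"
    by (rule tendsto_fpsI)
  then show ?thesis
    unfolding q_pochhammer_inf_def by (simp only: limI)
qed

lemma q_pochhammer_inf_fps_nth_0:
  fixes a x :: "'a::comm_ring_1 fps"
  assumes "a $ 0 = 0" "x $ 0 = 0"
  shows "q_pochhammer_inf a x $ 0 = 1"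
proof -
  have "\<forall>\<^sub>F n in sequentially. q_pochhammer a x n $ 0 = q_pochhammer_inf a x $ 0"
    using q_pochhammer_fps_tendsto[OF assms] by (simp add: tendsto_fps_iff)
  then show ?thesis
    using assms by (simp add: q_pochhammer_fps_nth_0)
qed

section \<open>Counting cylindric partitions with bounded parts\<close>

lemma is_partition_Nil [simp]: "is_partition []"
  by (simp add: is_partition_def)

lemma nth_part_le_head:
  assumes "is_partition xs"
  shows "nth_part xs j \<le> nth_part xs 0"
proof (cases "j < length xs \<and> j > 0")
  case True
  then have "0 < length xs" by linarith
  with True assms show ?thesis
    by (simp add: is_partition_def nth_default_nth sorted_wrt_iff_nth_less)
qed (auto simp: nth_default_beyond not_less)

lemma is_partition_Cons:
  "is_partition (x # xs) \<longleftrightarrow> x > 0 \<and> nth_part xs 0 \<le> x \<and> is_partition xs"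
proof (cases xs)
  case (Cons y ys)
  then show ?thesis
    by (auto simp: is_partition_def)
qed (auto simp: is_partition_def)

lemma partition_bounded_0:
  assumes "is_partition xs" "nth_part xs 0 \<le> 0"
  shows "xs = []"
  using assms by (cases xs) (auto simp: is_partition_def)

lemma nth_part_le_sum_list: "nth_part xs j \<le> sum_list xs"
  by (cases "j < length xs") (auto simp: nth_default_nth nth_default_beyond elem_le_sum_list)

lemma length_le_sum_list_partition:
  assumes "is_partition xs"
  shows "length xs \<le> sum_list xs"
  using assms by (induction xs) (auto simp: is_partition_Cons)

lemma finite_partitions_le: "finite {xs. is_partition xs \<and> sum_list xs \<le> k}"
proof (rule finite_subset)
  show "{xs. is_partition xs \<and> sum_list xs \<le> k} \<subseteq> {xs. set xs \<subseteq> {..k} \<and> length xs \<le> k}"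
    using length_le_sum_list_partition member_le_sum_list by fastforce
qed (simp add: finite_lists_length_le)

text \<open>The profile of \<open>cyl_pairs a b N k\<close> is \<open>(a, b)\<close>; \<open>N\<close> bounds the parts and \<open>k\<close> is the size.\<close>

definition cyl_pairs :: "nat \<Rightarrow> nat \<Rightarrow> nat \<Rightarrow> nat \<Rightarrow> (nat list \<times> nat list) set" where
  "cyl_pairs a b N k =
     {(xs, ys). is_partition xs \<and> is_partition ys \<and>
        (\<forall>j. nth_part ys (j + b) \<le> nth_part xs j) \<and> (\<forall>j. nth_part xs (j + a) \<le> nth_part ys j) \<and>
        nth_part xs 0 \<le> N \<and> nth_part ys 0 \<le> N \<and> sum_list xs + sum_list ys = k}"

lemma finite_cyl_pairs [simp]: "finite (cyl_pairs a b N k)"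
proof (rule finite_subset)
  show "cyl_pairs a b N k \<subseteq> {xs. is_partition xs \<and> sum_list xs \<le> k} \<times> {xs. is_partition xs \<and> sum_list xs \<le> k}"
    by (auto simp: cyl_pairs_def)
qed (simp add: finite_partitions_le)

text \<open>Turning the cylinder by one step exchanges the components and, with them, the two
  interlacing conditions.\<close>

lemma card_cyl_pairs_swap: "card (cyl_pairs a b N k) = card (cyl_pairs b a N k)"
  by (rule bij_betw_same_card[where f = prod.swap], rule bij_betwI[where g = prod.swap])
     (auto simp: cyl_pairs_def)

lemma card_cyl_pairs_0: "card (cyl_pairs a b 0 k) = (if k = 0 then 1 else 0)"
proof -
  have "cyl_pairs a b 0 k = (if k = 0 then {([], [])} else {})"
    by (auto simp: cyl_pairs_def dest: partition_bounded_0)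
  then show ?thesis by simp
qed

text \<open>Deleting a largest part \<open>N\<close> from the first component moves one unit of the profile.\<close>

lemma card_cyl_pairs_head:
  assumes "N > 0" "M \<le> N"
  shows "card {(xs, ys) \<in> cyl_pairs (Suc a) b N k. nth_part xs 0 = N \<and> nth_part ys 0 \<le> M} =
         (if N \<le> k then card {(xs, ys) \<in> cyl_pairs a (Suc b) N (k - N). nth_part ys 0 \<le> M} else 0)"
    (is "card ?L = (if _ then card ?R else 0)")
proof (cases "N \<le> k")
  case True
  have "bij_betw (map_prod ((#) N) id) ?R ?L"
  proof (rule bij_betw_imageI)
    show "inj_on (map_prod ((#) N) id) ?R"
      by (auto simp: inj_on_def)
    show "map_prod ((#) N) id ` ?R = ?L"
    proof (intro equalityI subsetI)
      fix p assume "p \<in> map_prod ((#) N) id ` ?R"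
      then obtain xs ys where p: "p = (N # xs, ys)" and R: "(xs, ys) \<in> ?R" by auto
      from R have ys: "is_partition ys" "nth_part ys 0 \<le> N"
        and 1: "\<And>j. nth_part ys (Suc (j + b)) \<le> nth_part xs j"
        by (auto simp: cyl_pairs_def)
      \<comment> \<open>Putting \<open>N\<close> in front shifts the indices of \<open>xs\<close> by
        one. The inequality at j = 0 has no counterpart among the old ones; it follows from the
        bound \<open>N\<close> on \<open>ys\<close>.\<close>
      have "nth_part ys (j + b) \<le> nth_part (N # xs) j" for j
        using nth_part_le_head[OF ys(1), of b] ys(2) 1 by (cases j) auto
      with R True assms(1) show "p \<in> ?L"
        by (auto simp: p cyl_pairs_def is_partition_Cons)
    next
      fix p assume "p \<in> ?L"
      then obtain xs ys where p: "p = (xs, ys)" and L: "(xs, ys) \<in> ?L" by auto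
      with assms(1) obtain xs' where xs: "xs = N # xs'" by (cases xs) auto
      have "nth_part ys (Suc (j + b)) \<le> nth_part xs' j" for j
        using L by (auto simp: cyl_pairs_def xs dest!: spec[where x = "Suc j"])
      with L show "p \<in> map_prod ((#) N) id ` ?R"
        by (auto simp: p xs cyl_pairs_def is_partition_Cons intro!: image_eqI[where x = "(xs', ys)"])
    qed
  qed
  with True show ?thesis
    by (simp add: bij_betw_same_card)
next
  case False
  have "nth_part xs 0 \<noteq> N" if "(xs, ys) \<in> cyl_pairs (Suc a) b N k" for xs ys
    using that False nth_part_le_sum_list[of xs 0] by (auto simp: cyl_pairs_def)
  then have L: "?L = {}" by auto
  show ?thesis unfolding L using False by simp
qed

text \<open>As the second entry of the profile is 0, \<open>xs\<close> dominates \<open>ys\<close>,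
  so if \<open>Suc N\<close> occurs at all, it heads \<open>xs\<close>. Deleting it there leads to
  profile (2, 1).\<close>

lemma card_cyl_pairs_30:
  "card (cyl_pairs 3 0 (Suc N) k) =
     card (cyl_pairs 3 0 N k) + (if Suc N \<le> k then card (cyl_pairs 2 1 (Suc N) (k - Suc N)) else 0)"
proof -
  let ?H = "{(xs, ys) \<in> cyl_pairs (Suc 2) 0 (Suc N) k. nth_part xs 0 = Suc N \<and> nth_part ys 0 \<le> Suc N}"
  have le: "nth_part ys 0 \<le> nth_part xs 0" if "(xs, ys) \<in> cyl_pairs 3 0 M k" for xs ys M
    using that by (auto simp: cyl_pairs_def)
  have "cyl_pairs 3 0 (Suc N) k = cyl_pairs 3 0 N k \<union> ?H"
    using le by (fastforce simp: cyl_pairs_def le_Suc_eq numeral_3_eq_3)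
  moreover have "cyl_pairs 3 0 N k \<inter> ?H = {}"
    by (auto simp: cyl_pairs_def)
  moreover have "{(xs, ys) \<in> cyl_pairs 2 1 (Suc N) m. nth_part ys 0 \<le> Suc N} = cyl_pairs 2 1 (Suc N) m" for m
    by (auto simp: cyl_pairs_def)
  moreover have "finite ?H"
    by (rule finite_subset[of _ "cyl_pairs (Suc 2) 0 (Suc N) k"]) auto
  ultimately show ?thesis
    using card_cyl_pairs_head[of "Suc N" "Suc N" 2 0 k] card_Un_disjoint[of "cyl_pairs 3 0 N k" ?H]
    by (simp only: finite_cyl_pairs zero_less_Suc order.refl if_True simp_thms One_nat_def)
qed

text \<open>Three cases: no part is \<open>Suc N\<close>; or \<open>xs\<close> starts with it, and
  deletion gives profile (1, 2), a swap of (2, 1); or only \<open>ys\<close> does, and deletion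
  after a swap gives (0, 3), a swap of (3, 0).\<close>

lemma card_cyl_pairs_21:
  "card (cyl_pairs 2 1 (Suc N) k) =
     card (cyl_pairs 2 1 N k) +
     (if Suc N \<le> k then card (cyl_pairs 2 1 (Suc N) (k - Suc N)) + card (cyl_pairs 3 0 N (k - Suc N))
      else 0)"
proof -
  let ?H = "{(xs, ys) \<in> cyl_pairs (Suc 1) 1 (Suc N) k. nth_part xs 0 = Suc N \<and> nth_part ys 0 \<le> Suc N}"
  \<comment> \<open>The components are listed in reverse, so that \<open>card_cyl_pairs_head\<close>
    deletes from \<open>ys\<close>. The bound on \<open>xs\<close> is only \<open>N\<close>, which
    keeps this case disjoint from \<open>?H\<close>.\<close>
  let ?G = "{(ys, xs) \<in> cyl_pairs (Suc 0) 2 (Suc N) k. nth_part ys 0 = Suc N \<and> nth_part xs 0 \<le> N}"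
  have "cyl_pairs 2 1 (Suc N) k = cyl_pairs 2 1 N k \<union> (?H \<union> prod.swap ` ?G)"
    by (auto simp: cyl_pairs_def le_Suc_eq image_iff numeral_2_eq_2)
  moreover have "cyl_pairs 2 1 N k \<inter> (?H \<union> prod.swap ` ?G) = {}" "?H \<inter> prod.swap ` ?G = {}"
    by (auto simp: cyl_pairs_def)
  moreover have fin: "finite ?H" "finite ?G"
    by (rule finite_subset[of _ "cyl_pairs (Suc 1) 1 (Suc N) k"], auto)
       (rule finite_subset[of _ "cyl_pairs (Suc 0) 2 (Suc N) k"], auto)
  ultimately have *: "card (cyl_pairs 2 1 (Suc N) k) = card (cyl_pairs 2 1 N k) + (card ?H + card ?G)"
    by (simp add: card_Un_disjoint card_image)
  have **: "{(xs, ys) \<in> cyl_pairs 1 2 (Suc N) m. nth_part ys 0 \<le> Suc N} = cyl_pairs 1 2 (Suc N) m" for m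
    by (auto simp: cyl_pairs_def)
  \<comment> \<open>In profile (0, 3) the second component dominates the first, so its bound
    \<open>N\<close> holds for both.\<close>
  have ***: "{(ys, xs) \<in> cyl_pairs 0 3 (Suc N) m. nth_part xs 0 \<le> N} = cyl_pairs 0 3 N m" for m
    by (auto simp: cyl_pairs_def le_Suc_eq) (metis not_less_eq_eq)+
  have "card ?H = (if Suc N \<le> k then card (cyl_pairs 2 1 (Suc N) (k - Suc N)) else 0)"
    using card_cyl_pairs_head[of "Suc N" "Suc N" 1 1 k] **
    by (simp add: card_cyl_pairs_swap[of 2 "Suc 0"] numeral_2_eq_2[symmetric])
  moreover have "card ?G = (if Suc N \<le> k then card (cyl_pairs 3 0 N (k - Suc N)) else 0)"
    using card_cyl_pairs_head[of "Suc N" N 0 2 k] ***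
    by (simp add: card_cyl_pairs_swap[of 3 0])
  ultimately show ?thesis
    using * by simp
qed

section \<open>Generating functions of the counts\<close>

definition cyl_gf :: "nat \<Rightarrow> nat \<Rightarrow> nat \<Rightarrow> rat fps" where
  "cyl_gf a b N = Abs_fps (\<lambda>k. of_nat (card (cyl_pairs a b N k)))"

lemma cyl_gf_0: "cyl_gf a b 0 = 1"
  by (rule fps_ext) (simp add: cyl_gf_def card_cyl_pairs_0)

lemma cyl_gf_30: "cyl_gf 3 0 (Suc N) = cyl_gf 3 0 N + fps_X ^ Suc N * cyl_gf 2 1 (Suc N)"
  by (rule fps_ext)
     (simp add: cyl_gf_def card_cyl_pairs_30 fps_X_power_mult_nth del: power_Suc)

lemma cyl_gf_21:
  "cyl_gf 2 1 (Suc N) = cyl_gf 2 1 N + fps_X ^ Suc N * (cyl_gf 2 1 (Suc N) + cyl_gf 3 0 N)"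
  unfolding fps_eq_iff fps_add_nth fps_X_power_mult_nth
  by (subst cyl_gf_def, subst card_cyl_pairs_21) (simp add: cyl_gf_def)

text \<open>No part exceeds the size, so for size k the bound k on the parts is no
  restriction.\<close>

lemma cylindric_partitions_30:
  "\<Lambda> \<in> cylindric_partitions [3, 0] \<and> cylindric_size \<Lambda> = k \<longleftrightarrow>
     \<Lambda> \<in> (\<lambda>(xs, ys). [xs, ys]) ` cyl_pairs 3 0 k k"
proof
  assume "\<Lambda> \<in> cylindric_partitions [3, 0] \<and> cylindric_size \<Lambda> = k"
  then obtain xs ys where \<Lambda>: "\<Lambda> = [xs, ys]" and "[xs, ys] \<in> cylindric_partitions [3, 0]"
    and k: "sum_list xs + sum_list ys = k"
    by (auto simp: cylindric_partitions_def cylindric_size_def length_Suc_conv numeral_2_eq_2)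
  then have "(xs, ys) \<in> cyl_pairs 3 0 k k"
    using nth_part_le_sum_list[of xs 0] nth_part_le_sum_list[of ys 0]
    by (auto simp: cylindric_partitions_def cyl_pairs_def)
  then show "\<Lambda> \<in> (\<lambda>(xs, ys). [xs, ys]) ` cyl_pairs 3 0 k k"
    by (force simp: \<Lambda>)
qed (auto simp: cylindric_partitions_def cyl_pairs_def cylindric_size_def)

lemma cyl_gf_nth_stable:
  assumes "k \<le> N"
  shows "cyl_gf a b N $ k = of_nat (card (cyl_pairs a b k k))"
proof -
  have "nth_part xs 0 \<le> k \<and> nth_part ys 0 \<le> k" if "sum_list xs + sum_list ys = k" for xs ys
    using that nth_part_le_sum_list[of xs 0] nth_part_le_sum_list[of ys 0] by linarith
  with assms have "cyl_pairs a b N k = cyl_pairs a b k k"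
    by (fastforce simp: cyl_pairs_def)
  then show ?thesis
    by (simp add: cyl_gf_def)
qed

text \<open>Exactly the finitely many cylindric partitions of size k contribute to coefficient k,
  each with 1, and \<open>cyl_gf 3 0 N\<close> counts all of them once N \<ge> k.\<close>

lemma has_sum_cylindric_partitions_30:
  assumes "cyl_gf 3 0 \<longlonglongrightarrow> S"
  shows "((\<lambda>\<Lambda>. fps_X ^ cylindric_size \<Lambda>) has_sum S) (cylindric_partitions [3, 0])"
proof (rule has_sum_fpsI)
  fix k
  let ?P = "{\<Lambda> \<in> cylindric_partitions [3, 0]. (fps_X ^ cylindric_size \<Lambda> :: rat fps) $ k \<noteq> 0}"
  have P: "?P = (\<lambda>(xs, ys). [xs, ys]) ` cyl_pairs 3 0 k k"
    unfolding set_eq_iff cylindric_partitions_30[symmetric] by auto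
  show "finite ?P"
    unfolding P by simp
  have "\<forall>\<^sub>F N in sequentially. cyl_gf 3 0 N $ k = S $ k"
    using assms by (simp add: tendsto_fps_iff)
  with eventually_ge_at_top[of k] have "\<forall>\<^sub>F N in sequentially. S $ k = of_nat (card (cyl_pairs 3 0 k k))"
    by eventually_elim (simp add: cyl_gf_nth_stable)
  then have S: "S $ k = of_nat (card (cyl_pairs 3 0 k k))"
    by simp
  have "card ?P = card (cyl_pairs 3 0 k k)"
    unfolding P by (rule card_image) (auto simp: inj_on_def)
  moreover have "(\<Sum>\<Lambda>\<in>?P. (fps_X ^ cylindric_size \<Lambda> :: rat fps) $ k) = (\<Sum>\<Lambda>\<in>?P. 1)"
    by (rule sum.cong) (auto split: if_splits)
  ultimately show "S $ k = (\<Sum>\<Lambda>\<in>?P. (fps_X ^ cylindric_size \<Lambda>) $ k)"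
    unfolding S by (simp only: sum_constant mult_1_right)
qed

section \<open>Convolutions of reciprocal q-factorials\<close>

lemma q_pochhammer_add:
  "q_pochhammer a x (n + m) = q_pochhammer a x n * q_pochhammer (a * x ^ n) x m"
  by (induction m) (simp_all add: q_pochhammer_Suc power_add ac_simps)

text \<open>Each factor is a difference of squares. Later this splits (q^4;q^4)_n into (q^2;q^2)_n
  (-q^2;q^2)_n.\<close>

lemma q_pochhammer_square:
  "q_pochhammer (a\<^sup>2) (x\<^sup>2) n = q_pochhammer a x n * q_pochhammer (- a) x n"
  by (induction n)
     (simp_all add: q_pochhammer_Suc power2_eq_square power_mult_distrib algebra_simps)

abbreviation inv_qpoch :: "'a::field fps \<Rightarrow> nat \<Rightarrow> 'a fps" where
  "inv_qpoch x n \<equiv> inverse (q_pochhammer x x n)"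

lemma inv_qpoch_Suc:
  assumes "x $ 0 = 0"
  shows "inv_qpoch x (Suc n) * (1 - x ^ Suc n) = inv_qpoch x n"
proof -
  have "(1 - x ^ Suc n) $ 0 \<noteq> 0"
    using assms by simp
  then have "inverse (1 - x ^ Suc n) * (1 - x ^ Suc n) = 1"
    by (rule inverse_mult_eq_1)
  then show ?thesis
    by (simp add: q_pochhammer_Suc fps_inverse_mult mult.assoc)
qed

text \<open>If \<open>x\<close> has no constant term, this is the sum of \<open>a n\<close> times
  the Gaussian binomial coefficient [N choose n] in base \<open>x\<close>, divided by (x;x)_N. The
  convolution form is the one in which N can tend to infinity.\<close>

definition qconv :: "'a::field fps \<Rightarrow> (nat \<Rightarrow> 'a fps) \<Rightarrow> nat \<Rightarrow> 'a fps" where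
  "qconv x a N = (\<Sum>n\<le>N. a n * inv_qpoch x n * inv_qpoch x (N - n))"

lemma qconv_0 [simp]: "qconv x a 0 = a 0"
  by (simp add: qconv_def)

lemma qconv_cong: "(\<And>n. n \<le> N \<Longrightarrow> a n = b n) \<Longrightarrow> qconv x a N = qconv x b N"
  by (simp add: qconv_def)

lemma qconv_add: "qconv x (\<lambda>n. a n + b n) N = qconv x a N + qconv x b N"
  by (simp add: qconv_def algebra_simps sum.distrib)

lemma qconv_cmult: "qconv x (\<lambda>n. c * a n) N = c * qconv x a N"
  by (simp add: qconv_def sum_distrib_left mult.assoc)

lemma qconv_rev: "qconv x a N = qconv x (\<lambda>n. a (N - n)) N"
  unfolding qconv_def
  by (rule sum.reindex_bij_witness[where i = "\<lambda>n. N - n" and j = "\<lambda>n. N - n"]) (auto simp: ac_simps)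

text \<open>The extra factor cancels the last one in the denominator of
  \<open>inv_qpoch x (Suc N - n)\<close> and vanishes at n = \<open>Suc N\<close>.\<close>

lemma qconv_drop_right:
  assumes "x $ 0 = 0"
  shows "qconv x (\<lambda>n. a n * (1 - x ^ (Suc N - n))) (Suc N) = qconv x a N"
proof -
  have "inv_qpoch x (Suc N - n) * (1 - x ^ (Suc N - n)) = inv_qpoch x (N - n)" if "n \<le> N" for n
    using inv_qpoch_Suc[OF assms, of "N - n"] that by (simp add: Suc_diff_le)
  then show ?thesis
    unfolding qconv_def sum.atMost_Suc by (auto intro!: sum.cong simp: mult.commute mult.left_commute)
qed

text \<open>Here the cancellation is in \<open>inv_qpoch x n\<close>, and the term at n = 0
  vanishes.\<close>

lemma qconv_drop_left:
  assumes "x $ 0 = 0"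
  shows "qconv x (\<lambda>n. a n * (1 - x ^ n)) (Suc N) = qconv x (\<lambda>n. a (Suc n)) N"
proof -
  have "a (Suc n) * (1 - x ^ Suc n) * inv_qpoch x (Suc n) = a (Suc n) * inv_qpoch x n" for n
    using inv_qpoch_Suc[OF assms, of n] by (simp add: mult.assoc mult.commute)
  then show ?thesis
    unfolding qconv_def sum.atMost_Suc_shift
    by (simp only: power_0 diff_self mult_zero_right mult_zero_left add_0_left diff_Suc_Suc)
qed

text \<open>The splitting \<open>1 - x^N = (1 - x^(N-n)) + x^(N-n) (1 - x^n)\<close> is the one behind Pascal's rule for
  Gaussian binomial coefficients.\<close>

lemma qconv_Suc:
  assumes "x $ 0 = 0"
  shows "(1 - x ^ Suc N) * qconv x a (Suc N) =
         qconv x a N + qconv x (\<lambda>n. a (Suc n) * x ^ (N - n)) N"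
proof -
  have "(1 - x ^ Suc N) * qconv x a (Suc N) =
        qconv x (\<lambda>n. a n * (1 - x ^ (Suc N - n)) + (a n * x ^ (Suc N - n)) * (1 - x ^ n)) (Suc N)"
    unfolding qconv_cmult [symmetric]
    by (rule qconv_cong) (simp add: algebra_simps flip: power_add power_Suc)
  then show ?thesis
    unfolding qconv_add using qconv_drop_right[OF assms, of a] qconv_drop_left[OF assms, of "\<lambda>n. a n * x ^ (Suc N - n)"]
    by simp
qed

lemma fps_one_minus_power_cancel:
  fixes x :: "'a::field fps"
  assumes "x $ 0 = 0" "(1 - x ^ Suc N) * F = (1 - x ^ Suc N) * G"
  shows "F = G"
proof -
  have "(1 - x ^ Suc N) $ 0 \<noteq> 0"
    using assms(1) by simp
  then have "1 - x ^ Suc N \<noteq> 0"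
    by (metis fps_zero_nth)
  with assms(2) show ?thesis
    by simp
qed

section \<open>Finite identities obtained from recurrences\<close>

lemma fps_X_nth_zero: "fps_X $ 0 = 0"
  by simp

text \<open>Both sides satisfy the same recurrences and agree at N = 0. Profile (2, 1) comes first,
  because the recurrence for (3, 0) refers to it at \<open>Suc N\<close>.\<close>

lemma cyl_gf_eq_qconv:
  "cyl_gf 2 1 N = qconv fps_X (\<lambda>n. fps_X ^ n\<^sup>2) N \<and>
   cyl_gf 3 0 N = qconv fps_X (\<lambda>n. fps_X ^ (n\<^sup>2 + n)) N"
proof (induction N)
  case (Suc N)
  let ?A = "qconv fps_X (\<lambda>n. fps_X ^ n\<^sup>2) :: nat \<Rightarrow> rat fps"
  let ?B = "qconv fps_X (\<lambda>n. fps_X ^ (n\<^sup>2 + n)) :: nat \<Rightarrow> rat fps"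
  have "(1 - fps_X ^ Suc N) * ?A (Suc N) =
        ?A N + qconv fps_X (\<lambda>n. fps_X ^ (Suc n)\<^sup>2 * fps_X ^ (N - n)) N"
    by (rule qconv_Suc) simp
  \<comment> \<open>The exponents match by (n+1)^2 + (N-n) = (N+1) + (n^2+n).\<close>
  also have "qconv fps_X (\<lambda>n. fps_X ^ (Suc n)\<^sup>2 * fps_X ^ (N - n)) N = fps_X ^ Suc N * ?B N"
    unfolding qconv_cmult [symmetric] power_add [symmetric]
    by (intro qconv_cong arg_cong2[where f = power] refl) (simp add: power2_eq_square)
  also have "?A N + \<dots> = (1 - fps_X ^ Suc N) * cyl_gf 2 1 (Suc N)"
    using cyl_gf_21[of N] Suc.IH by (simp add: algebra_simps)
  finally have A: "?A (Suc N) = cyl_gf 2 1 (Suc N)"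
    by (rule fps_one_minus_power_cancel[OF fps_X_nth_zero])
  \<comment> \<open>The power x^(N+1-n) is subtracted and added back, and x^(n^2+n) x^(N+1-n) =
    x^(N+1) x^(n^2).\<close>
  have "?B (Suc N) = qconv fps_X (\<lambda>n. fps_X ^ (n\<^sup>2 + n) * (1 - fps_X ^ (Suc N - n)) + fps_X ^ Suc N * fps_X ^ n\<^sup>2) (Suc N)"
    by (rule qconv_cong) (simp add: algebra_simps flip: power_add power_Suc)
  also have "\<dots> = ?B N + fps_X ^ Suc N * ?A (Suc N)"
    unfolding qconv_add qconv_cmult by (simp add: qconv_drop_right)
  also have "\<dots> = cyl_gf 3 0 (Suc N)"
    using cyl_gf_30[of N] A Suc.IH by simp
  finally show ?case
    using A by simp
qed (simp add: cyl_gf_0)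

lemma one_minus_mult_eqI:
  fixes c :: "'a::comm_ring_1"
  assumes "c * h = e" "h = d + e"
  shows "(1 - c) * h = d"
  using assms by (simp add: left_diff_distrib)

text \<open>Multiplied by (x^2;x^2)_N, this evaluates a Gaussian binomial sum in base x^2 to
  (-x;x)_N. Reversing the sum absorbs \<open>x ^ Suc N\<close> into the weights, since (N+1) +
  (N+1-n) = n + 2(N+1-n); this yields the recurrence of 1/(x;x)_N.\<close>

lemma inv_qpoch_eq_qconv_square:
  assumes "x $ 0 = 0"
  shows "inv_qpoch x N = qconv (x\<^sup>2) (\<lambda>n. x ^ n) N"
proof (induction N)
  case (Suc N)
  have "x ^ Suc N * qconv (x\<^sup>2) (\<lambda>n. x ^ n) (Suc N) = qconv (x\<^sup>2) (\<lambda>n. x ^ n * (x\<^sup>2) ^ (Suc N - n)) (Suc N)"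
    unfolding qconv_rev[of _ "\<lambda>n. x ^ n"] qconv_cmult [symmetric]
    unfolding power_add [symmetric] power_mult [symmetric]
    by (intro qconv_cong arg_cong2[where f = power] refl) simp
  moreover have "qconv (x\<^sup>2) (\<lambda>n. x ^ n) (Suc N) =
      qconv (x\<^sup>2) (\<lambda>n. x ^ n * (1 - (x\<^sup>2) ^ (Suc N - n))) (Suc N) +
      qconv (x\<^sup>2) (\<lambda>n. x ^ n * (x\<^sup>2) ^ (Suc N - n)) (Suc N)"
    unfolding qconv_add [symmetric] by (rule qconv_cong) (simp only: right_diff_distrib mult_1_right diff_add_cancel)
  ultimately have "(1 - x ^ Suc N) * qconv (x\<^sup>2) (\<lambda>n. x ^ n) (Suc N) =
      qconv (x\<^sup>2) (\<lambda>n. x ^ n * (1 - (x\<^sup>2) ^ (Suc N - n))) (Suc N)"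
    by (rule one_minus_mult_eqI)
  also have "\<dots> = qconv (x\<^sup>2) (\<lambda>n. x ^ n) N"
    using assms by (intro qconv_drop_right) (simp add: power2_eq_square)
  also have "\<dots> = (1 - x ^ Suc N) * inv_qpoch x (Suc N)"
    using Suc.IH inv_qpoch_Suc[OF assms, of N] by (simp add: mult.commute)
  finally show ?case
    using fps_one_minus_power_cancel[OF assms] by metis
qed simp

text \<open>A finite form of Euler's identity, with n a fixed shift. By \<open>qconv_Suc\<close> the
  left-hand side F_M satisfies (1 - x^(2M+2)) F_(M+1) = (1 + x^(2n+2+2M)) F_M, and so does the
  right-hand side.\<close>

lemma q_binomial_theorem:
  assumes "x $ 0 = 0"
  shows "qconv (x\<^sup>2) (\<lambda>m. x ^ (m\<^sup>2 + m + 2 * n * m)) M =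
         q_pochhammer (- (x\<^sup>2 * (x\<^sup>2) ^ n)) (x\<^sup>2) M * inv_qpoch (x\<^sup>2) M"
proof (induction M)
  case (Suc M)
  have x2: "(x\<^sup>2) $ 0 = 0"
    using assms by (simp add: power2_eq_square)
  let ?R = "qconv (x\<^sup>2) (\<lambda>m. x ^ (m\<^sup>2 + m + 2 * n * m))"
  have "(1 - (x\<^sup>2) ^ Suc M) * ?R (Suc M) =
        ?R M + qconv (x\<^sup>2) (\<lambda>m. x ^ ((Suc m)\<^sup>2 + Suc m + 2 * n * Suc m) * (x\<^sup>2) ^ (M - m)) M"
    by (rule qconv_Suc[OF x2])
  also have "qconv (x\<^sup>2) (\<lambda>m. x ^ ((Suc m)\<^sup>2 + Suc m + 2 * n * Suc m) * (x\<^sup>2) ^ (M - m)) M =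
             x\<^sup>2 * (x\<^sup>2) ^ n * (x\<^sup>2) ^ M * ?R M"
    unfolding qconv_cmult [symmetric] power_add [symmetric] power_mult [symmetric]
    by (intro qconv_cong arg_cong2[where f = power] refl) (simp add: power2_eq_square algebra_simps)
  also have "?R M + \<dots> = (1 + x\<^sup>2 * (x\<^sup>2) ^ n * (x\<^sup>2) ^ M) * ?R M"
    by (simp add: algebra_simps)
  also have "\<dots> = (1 - (x\<^sup>2) ^ Suc M) *
      (q_pochhammer (- (x\<^sup>2 * (x\<^sup>2) ^ n)) (x\<^sup>2) (Suc M) * inv_qpoch (x\<^sup>2) (Suc M))"
    unfolding Suc.IH inv_qpoch_Suc[OF x2, of M, symmetric]
    by (simp add: q_pochhammer_Suc[of "- _"] ac_simps del: power_Suc)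
  finally show ?case
    by (rule fps_one_minus_power_cancel[OF x2])
qed simp

section \<open>Passage to infinite series\<close>

lemma inv_qpoch_tendsto:
  assumes "x $ 0 = 0"
  shows "inv_qpoch x \<longlonglongrightarrow> inverse (q_pochhammer_inf x x)"
  using assms by (intro tendsto_inverse_fps q_pochhammer_fps_tendsto) (simp_all add: q_pochhammer_inf_fps_nth_0)

lemma fps_X_power_mult_nth_below:
  assumes "k < n" "n \<le> m"
  shows "(fps_X ^ m * F) $ k = 0"
  using assms by (simp add: fps_X_power_mult_nth)

text \<open>As M tends to infinity, the two sides of \<open>q_binomial_theorem\<close> tend to a
  series and an infinite product, each times 1/(q^2;q^2)_inf, which is nonzero and cancels.\<close>

lemma q_pochhammer_inf_eq_suminf:
  "q_pochhammer_inf (- (fps_X\<^sup>2 * (fps_X\<^sup>2) ^ n)) (fps_X\<^sup>2) =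
     (\<Sum>m. fps_X ^ (m\<^sup>2 + m + 2 * n * m) * inv_qpoch (fps_X\<^sup>2) m :: 'a::field fps)"
proof -
  let ?x = "fps_X :: 'a fps"
  let ?g = "\<lambda>m. ?x ^ (m\<^sup>2 + m + 2 * n * m) * inv_qpoch (?x\<^sup>2) m"
  let ?E = "inverse (q_pochhammer_inf (?x\<^sup>2) (?x\<^sup>2))"
  let ?P = "q_pochhammer_inf (- (?x\<^sup>2 * (?x\<^sup>2) ^ n)) (?x\<^sup>2)"
  have x2: "(?x\<^sup>2) $ 0 = 0"
    by simp
  have g: "?g m $ k = 0" if "k < m" for m k
    using that by (rule fps_X_power_mult_nth_below) simp
  have "(\<lambda>M. qconv (?x\<^sup>2) (\<lambda>m. ?x ^ (m\<^sup>2 + m + 2 * n * m)) M) \<longlonglongrightarrow> suminf ?g * ?E"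
    unfolding qconv_def using g inv_qpoch_tendsto[OF x2] by (rule tendsto_fps_convolution)
  moreover have "(\<lambda>M. qconv (?x\<^sup>2) (\<lambda>m. ?x ^ (m\<^sup>2 + m + 2 * n * m)) M) \<longlonglongrightarrow> ?P * ?E"
    unfolding q_binomial_theorem[OF fps_X_nth_zero]
    by (intro tendsto_fps_mult inv_qpoch_tendsto q_pochhammer_fps_tendsto) simp_all
  ultimately have eq: "suminf ?g * ?E = ?P * ?E"
    by (rule LIMSEQ_unique)
  have "?E $ 0 \<noteq> 0"
    using q_pochhammer_inf_fps_nth_0[OF x2 x2] by simp
  then have "?E \<noteq> 0"
    by (metis fps_zero_nth)
  from mult_right_cancel[OF this, THEN iffD1, OF eq] show ?thesis ..
qed

lemma q_pochhammer_inf_split: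
  fixes a x :: "'a::comm_ring_1 fps"
  assumes "a $ 0 = 0" "x $ 0 = 0"
  shows "q_pochhammer_inf a x = q_pochhammer a x n * q_pochhammer_inf (a * x ^ n) x"
proof (rule LIMSEQ_unique)
  show "(\<lambda>m. q_pochhammer a x (m + n)) \<longlonglongrightarrow> q_pochhammer_inf a x"
    using assms by (intro LIMSEQ_ignore_initial_segment q_pochhammer_fps_tendsto)
  show "(\<lambda>m. q_pochhammer a x (m + n)) \<longlonglongrightarrow> q_pochhammer a x n * q_pochhammer_inf (a * x ^ n) x"
    unfolding add.commute[of _ n] q_pochhammer_add using assms
    by (intro tendsto_fps_mult tendsto_const q_pochhammer_fps_tendsto) simp_all
qed

text \<open>A double array \<open>t n m\<close> is summed in two ways: row n gives the n-th term on
  the right by Euler's identity, and the diagonal n + m = N gives the N-th term on the left.\<close>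

lemma rogers_transformation:
  "(\<Sum>n. fps_X ^ (n\<^sup>2 + n) * inv_qpoch fps_X n) =
   (\<Sum>n. fps_X ^ (n\<^sup>2 + 2 * n) / q_pochhammer (fps_X ^ 4) (fps_X ^ 4) n) *
   (q_pochhammer_inf (- (fps_X\<^sup>2)) (fps_X\<^sup>2) :: 'a::field fps)"
proof -
  let ?x = "fps_X :: 'a fps"
  let ?y = "?x\<^sup>2"
  let ?P = "q_pochhammer_inf (- ?y) ?y"
  define f where "f = inv_qpoch ?y"
  define T where "T n = (\<Sum>m. ?x ^ (m\<^sup>2 + m + 2 * n * m) * f m)" for n
  define t where "t n m = ?x ^ (n\<^sup>2 + 2 * n) * f n * (?x ^ (m\<^sup>2 + m + 2 * n * m) * f m)" for n m
  have frac: "?x ^ (n\<^sup>2 + 2 * n) / q_pochhammer (?x ^ 4) (?x ^ 4) n =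
      ?x ^ (n\<^sup>2 + 2 * n) * (f n * inverse (q_pochhammer (- ?y) ?y n))" for n
    using q_pochhammer_square[of ?y ?y n]
    by (simp add: f_def fps_divide_unit q_pochhammer_fps_nth_0 fps_inverse_mult flip: power_mult)
  \<comment> \<open>The symbol (-q^2;q^2)_n in the denominator cancels the first n factors of
    \<open>?P\<close>; the remaining tail is \<open>T n\<close>.\<close>
  have quot: "?x ^ (n\<^sup>2 + 2 * n) / q_pochhammer (?x ^ 4) (?x ^ 4) n * ?P =
      ?x ^ (n\<^sup>2 + 2 * n) * f n * T n" for n
  proof -
    have "q_pochhammer (- ?y) ?y n $ 0 \<noteq> 0"
      by (simp add: q_pochhammer_fps_nth_0)
    then have "inverse (q_pochhammer (- ?y) ?y n) * q_pochhammer (- ?y) ?y n = 1"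
      by (rule inverse_mult_eq_1)
    moreover have "?P = q_pochhammer (- ?y) ?y n * T n"
      using q_pochhammer_inf_split[of "- ?y" ?y n] q_pochhammer_inf_eq_suminf[of n, where ?'a = 'a]
      by (simp add: T_def f_def)
    ultimately show ?thesis
      unfolding frac by (simp add: mult.assoc)
  qed
  have T_nth: "T n $ k = (\<Sum>m\<le>K. ?x ^ (m\<^sup>2 + m + 2 * n * m) * f m) $ k" if "k \<le> K" for n k K
    unfolding T_def
  proof (rule fps_suminf_nth)
    show "(?x ^ (m\<^sup>2 + m + 2 * n * m) * f m) $ k = 0" if "k < m" for m k
      using that by (rule fps_X_power_mult_nth_below) simp
  qed (rule that)
  have t_eq: "t n m = ?x ^ (n\<^sup>2 + 2 * n + (m\<^sup>2 + m + 2 * n * m)) * (f n * f m)" for n m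
    by (simp add: t_def power_add ac_simps)
  have t0: "t n m $ k = 0" if "k < n + m" for n m k
    unfolding t_eq using that by (rule fps_X_power_mult_nth_below) simp
  have diag: "(\<Sum>n\<le>N. t n (N - n)) = ?x ^ (N\<^sup>2 + N) * inv_qpoch ?x N" for N
  proof -
    have "t n (N - n) = ?x ^ (N\<^sup>2 + N) * (?x ^ n * f n * f (N - n))" if "n \<le> N" for n
    proof -
      from le_Suc_ex[OF that] obtain m where N: "N = n + m" ..
      \<comment> \<open>Besides N, only a single n is left in the exponent; it is the weight x^n of
        \<open>inv_qpoch_eq_qconv_square\<close>.\<close>
      have e: "n\<^sup>2 + 2 * n + (m\<^sup>2 + m + 2 * n * m) = N\<^sup>2 + N + n"
        by (simp add: N power2_eq_square algebra_simps)
      have "t n m = ?x ^ (N\<^sup>2 + N) * (?x ^ n * f n * f m)"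
        unfolding t_eq e by (simp only: power_add mult.assoc)
      then show ?thesis
        by (simp add: N)
    qed
    then show ?thesis
      unfolding inv_qpoch_eq_qconv_square[OF fps_X_nth_zero] qconv_def sum_distrib_left
      by (intro sum.cong) (simp_all add: f_def)
  qed
  have "(\<Sum>n. ?x ^ (n\<^sup>2 + n) * inv_qpoch ?x n) = (\<Sum>n. ?x ^ (n\<^sup>2 + 2 * n) * f n * T n)"
  proof (rule fps_ext)
    fix k
    \<comment> \<open>In degree k all sums may be cut off at k. The resulting square reduces by
      \<open>t0\<close> to the triangle n + m \<le> k, which is then summed along diagonals.\<close>
    have "(\<Sum>n. ?x ^ (n\<^sup>2 + 2 * n) * f n * T n) $ k = (\<Sum>n\<le>k. ?x ^ (n\<^sup>2 + 2 * n) * f n * T n) $ k"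
      unfolding mult.assoc by (rule fps_suminf_nth, erule fps_X_power_mult_nth_below, simp_all)
    also have "\<dots> = (\<Sum>n\<le>k. (?x ^ (n\<^sup>2 + 2 * n) * f n * (\<Sum>m\<le>k. ?x ^ (m\<^sup>2 + m + 2 * n * m) * f m)) $ k)"
      unfolding fps_sum_nth using T_nth by (intro sum.cong refl fps_mult_nth_cong) blast
    also have "\<dots> = (\<Sum>(n, m)\<in>{..k} \<times> {..k}. t n m $ k)"
      by (simp add: sum_distrib_left fps_sum_nth t_def flip: sum.cartesian_product)
    also have "\<dots> = (\<Sum>(n, m)\<in>{(n, m). n + m \<le> k}. t n m $ k)"
      by (rule sum.mono_neutral_right) (auto intro: t0 simp: not_le)
    also have "\<dots> = (\<Sum>N\<le>k. \<Sum>n\<le>N. t n (N - n) $ k)"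
      by (rule sum.triangle_reindex_eq)
    also have "\<dots> = (\<Sum>N\<le>k. ?x ^ (N\<^sup>2 + N) * inv_qpoch ?x N) $ k"
      by (simp add: fps_sum_nth flip: diag)
    also have "\<dots> = (\<Sum>n. ?x ^ (n\<^sup>2 + n) * inv_qpoch ?x n) $ k"
      by (rule fps_suminf_nth[symmetric], erule fps_X_power_mult_nth_below, simp_all)
    finally show "(\<Sum>n. ?x ^ (n\<^sup>2 + n) * inv_qpoch ?x n) $ k = (\<Sum>n. ?x ^ (n\<^sup>2 + 2 * n) * f n * T n) $ k" ..
  qed
  also have "\<dots> = (\<Sum>n. ?x ^ (n\<^sup>2 + 2 * n) / q_pochhammer (?x ^ 4) (?x ^ 4) n * ?P)"
    by (simp only: quot)
  also have "\<dots> = (\<Sum>n. ?x ^ (n\<^sup>2 + 2 * n) / q_pochhammer (?x ^ 4) (?x ^ 4) n) * ?P"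
    unfolding frac by (rule fps_suminf_mult[symmetric], erule fps_X_power_mult_nth_below, simp)
  finally show ?thesis .
qed

theorem theorem4p2:
  fixes q :: "rat fps"
  defines "q \<equiv> fps_X"
  shows "(\<Sum>\<^sub>\<infinity>\<Lambda>\<in>cylindric_partitions [3, 0]. q ^ cylindric_size \<Lambda>) =
           (\<Sum>n. q ^ (n^2 + 2 * n) / q_pochhammer (q^4) (q^4) n) *
           (q_pochhammer_inf (- (q^2)) (q^2) / q_pochhammer_inf q q)"
proof -
  have unit: "q_pochhammer_inf q q $ 0 \<noteq> 0"
    by (simp add: q_def q_pochhammer_inf_fps_nth_0)
  \<comment> \<open>This is a convolution of a summable sequence with the convergent sequence
    \<open>inv_qpoch q\<close>, so its limit is a product.\<close>
  have "cyl_gf 3 0 = (\<lambda>N. \<Sum>n\<le>N. q ^ (n\<^sup>2 + n) * inv_qpoch q n * inv_qpoch q (N - n))"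
    by (simp add: fun_eq_iff cyl_gf_eq_qconv qconv_def q_def)
  also have "\<dots> \<longlonglongrightarrow> (\<Sum>n. q ^ (n\<^sup>2 + n) * inv_qpoch q n) * inverse (q_pochhammer_inf q q)"
    unfolding q_def
    by (rule tendsto_fps_convolution, erule fps_X_power_mult_nth_below) (simp_all add: inv_qpoch_tendsto)
  finally have "(\<Sum>\<^sub>\<infinity>\<Lambda>\<in>cylindric_partitions [3, 0]. q ^ cylindric_size \<Lambda>) =
      (\<Sum>n. q ^ (n\<^sup>2 + n) * inv_qpoch q n) * inverse (q_pochhammer_inf q q)"
    unfolding q_def by (intro infsumI has_sum_cylindric_partitions_30)
  then show ?thesis
    using unit by (simp add: q_def rogers_transformation fps_divide_unit mult.assoc)
qed

end
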